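(* Let $X$ be a finite cell complex, let $q$ be a prime integer, let $i\ge 0$ be an integer, let $\beta_2,\beta_1\geq 0$, and let $\gamma\in C_i(X;\mathbb{Z}_q)$. Let $\mu=\mu_{\beta_2,\beta_1,q,i,X}$ be the Potts lattice Higgs model and let $\rho=\rho_{p_2,p_1,q,i,X}$ be the coupled plaquette percolation with $p_2=1-e^{-\beta_2}$ and $p_1=1-e^{-\beta_1}$. Then $$\mathbb{E}_{\mu}(W_\gamma)=\rho(V_{\gamma}).$$
   Context: For a cell complex $X$: $X^{[j]}$ is the set of $j$-cells and $X^{(j)}$ the $j$-skeleton. $C_j(X;\mathbb{Z}_q)$ is the group of $j$-chains (formal sums of oriented $j$-cells with coefficients in $\mathbb{Z}_q$, the integers modulo $q$, with $-x$ equal to $x$ with reversed orientation), $\partial$ is the cellular boundary map. $C^j(X;\mathbb{Z}_q)$ is the group of functions $f$ from oriented $j$-cells to $\mathbb{Z}_q$ with $f(-x)=-f(x)$, evaluated on chains by linearity; the coboundary is $\delta f(x)=f(\partial x)$. $I_x(y)$ is the indicator that $y=x$. A $j$-dimensional percolation subcomplex of $X$ is a subcomplex $P$ with $X^{(j-1)}\subseteq P\subseteq X^{(j)}$; $|P|$ is its number of $j$-cells. The Potts lattice Higgs model $\mu_{\beta_2,\beta_1,q,i,X}$ is the probability measure on $C^i(X;\mathbb{Z}_q)$ with $\mu(f)\propto \exp\bigl(\beta_2\sum_{\sigma\in X^{[i+1]}}I_0(\delta f(\sigma))+\beta_1\sum_{\epsilon\in X^{[i]}}I_0(f(\epsilon))\bigr)$.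 The coupled plaquette percolation $\rho_{p_2,p_1,q,i,X}$ is the probability measure on pairs $(P_2,P_1)$ of percolation subcomplexes of $X$ of dimensions $i+1$ and $i$ with $$\rho(P_2,P_1)\propto p_2^{|P_2|}(1-p_2)^{|X^{[i+1]}|-|P_2|}\,p_1^{|P_1|}(1-p_1)^{|X^{[i]}|-|P_1|}\,|H^i(P_2,P_1;\mathbb{Z}_q)|,$$ where the relative cohomology $H^i(P_2,P_1;\mathbb{Z}_q)$ coincides with the group of $f\in C^i(X;\mathbb{Z}_q)$ such that $f(\epsilon)=0$ for all $i$-cells $\epsilon$ of $P_1$ and $\delta f(\sigma)=0$ for all $(i+1)$-cells $\sigma$ of $P_2$. For $\gamma\in C_i(X;\mathbb{Z}_q)$, the Wilson observable is $W_\gamma(f)=\exp\bigl(\frac{2\pi \sqrt{-1}}{q}f(\gamma)\bigr)$, and $V_\gamma$ is the event that there exists an $(i+1)$-chain $\tau\in C_{i+1}(P_2;\mathbb{Z}_q)$ such that $\gamma-\partial\tau$ is supported on $P_1$; equivalently, $[\gamma]=0$ in $H_i(P_2,P_1;\mathbb{Z}_q)$. *)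

theory Defs
  imports "HOL-Homology.Homology" "HOL-Probability.Probability"
begin

definition closed_disc :: "nat \<Rightarrow> (nat \<Rightarrow> real) topology" where
  "closed_disc n = subtopology (Euclidean_space n) {x. (\<Sum>k<n. (x k)\<^sup>2) \<le> 1}"

definition open_disc :: "nat \<Rightarrow> (nat \<Rightarrow> real) set" where
  "open_disc n = {x \<in> topspace (Euclidean_space n). (\<Sum>k<n. (x k)\<^sup>2) < 1}"

text \<open>A cell complex is a space with a set of cells, their dimensions, and for every cell a
  characteristic map from the closed disc. The characteristic map also fixes the reference
  orientation of the cell.\<close>

record ('a, 'c) cell_complex =
  cw_space :: "'a topology"
  cw_cells :: "'c set"
  cw_dim :: "'c \<Rightarrow> nat"
  cw_char :: "'c \<Rightarrow> (nat \<Rightarrow> real) \<Rightarrow> 'a"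

definition open_cell :: "('a, 'c) cell_complex \<Rightarrow> 'c \<Rightarrow> 'a set" where
  "open_cell K e = cw_char K e ` open_disc (cw_dim K e)"

definition closed_cell :: "('a, 'c) cell_complex \<Rightarrow> 'c \<Rightarrow> 'a set" where
  "closed_cell K e = cw_char K e ` topspace (closed_disc (cw_dim K e))"

text \<open>Finite CW complexes. As there are only finitely many (compact) cells and the space is
  Hausdorff, the weak topology condition holds automatically, and the characteristic maps are
  automatically homeomorphisms from the open discs onto the open cells.\<close>

definition finite_cell_complex :: "('a, 'c) cell_complex \<Rightarrow> bool" where
  "finite_cell_complex K \<longleftrightarrow>
     Hausdorff_space (cw_space K) \<and>
     finite (cw_cells K) \<and>
     (\<forall>e\<in>cw_cells K. continuous_map (closed_disc (cw_dim K e)) (cw_space K) (cw_char K e)) \<and>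
     (\<forall>e\<in>cw_cells K. inj_on (cw_char K e) (open_disc (cw_dim K e))) \<and>
     disjoint_family_on (open_cell K) (cw_cells K) \<and>
     (\<Union>e\<in>cw_cells K. open_cell K e) = topspace (cw_space K) \<and>
     (\<forall>e\<in>cw_cells K.
        cw_char K e ` (topspace (closed_disc (cw_dim K e)) - open_disc (cw_dim K e))
          \<subseteq> (\<Union>e'\<in>{e'\<in>cw_cells K. cw_dim K e' < cw_dim K e}. open_cell K e'))"

text \<open>Subcomplexes are represented by their sets of cells.\<close>

definition subcomplex :: "('a, 'c) cell_complex \<Rightarrow> 'c set \<Rightarrow> bool" where
  "subcomplex K P \<longleftrightarrow>
     P \<subseteq> cw_cells K \<and> (\<forall>e\<in>P. closed_cell K e \<subseteq> (\<Union>e'\<in>P. open_cell K e'))"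

definition cells_in :: "('a, 'c) cell_complex \<Rightarrow> 'c set \<Rightarrow> nat \<Rightarrow> 'c set" where
  "cells_in K P j = {e \<in> P. cw_dim K e = j}"

abbreviation cells :: "('a, 'c) cell_complex \<Rightarrow> nat \<Rightarrow> 'c set" where
  "cells K j \<equiv> cells_in K (cw_cells K) j"

text \<open>The strict inequality in the lower bound describes the $(j-1)$-skeleton, which is empty
  for $j = 0$.\<close>

definition percolation_subcomplexes :: "('a, 'c) cell_complex \<Rightarrow> nat \<Rightarrow> 'c set set" where
  "percolation_subcomplexes K j =
     {P. subcomplex K P \<and>
         {e \<in> cw_cells K. cw_dim K e < j} \<subseteq> P \<and> P \<subseteq> {e \<in> cw_cells K. cw_dim K e \<le> j}}"

definition sphere_base :: "nat \<Rightarrow> real" where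
  "sphere_base = (\<lambda>k. if k = 0 then -1 else 0)"

text \<open>The map from the $n$-disc to the $n$-sphere that collapses the bounding sphere to the base
  point and is a homeomorphism elsewhere. The special coordinate is put first so that the map is
  orientation preserving when the sphere carries the outward-normal-first boundary orientation.
  In particular the boundary of a 1-cell is its endpoint at $1$ minus its endpoint at $-1$.\<close>

definition disc_collapse :: "nat \<Rightarrow> (nat \<Rightarrow> real) \<Rightarrow> nat \<Rightarrow> real" where
  "disc_collapse n y =
     (let r2 = (\<Sum>k<n. (y k)\<^sup>2)
      in (\<lambda>k. if k = 0 then 1 - 2 * r2 else if k \<le> n then 2 * sqrt (1 - r2) * y (k - 1) else 0))"

text \<open>The map from the $n$-skeleton to the $n$-sphere collapsing everything outside the open
  $n$-cell \<open>e\<close>.\<close>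

definition cell_collapse :: "('a, 'c) cell_complex \<Rightarrow> 'c \<Rightarrow> 'a \<Rightarrow> nat \<Rightarrow> real" where
  "cell_collapse K e x =
     (if x \<in> open_cell K e
      then disc_collapse (cw_dim K e) (inv_into (open_disc (cw_dim K e)) (cw_char K e) x)
      else sphere_base)"

text \<open>For \<open>cw_dim K s = Suc (cw_dim K e)\<close>, this is the coefficient of \<open>e\<close> in the cellular boundary
  of \<open>s\<close>: the degree of the attaching map of \<open>s\<close> followed by the collapse onto the sphere of \<open>e\<close>.
  The library's degree is defined through reduced homology, so the case of 0-cells needs no
  separate treatment.\<close>

definition incidence :: "('a, 'c) cell_complex \<Rightarrow> 'c \<Rightarrow> 'c \<Rightarrow> int" where
  "incidence K s e = Brouwer_degree2 (cw_dim K e) (cell_collapse K e \<circ> cw_char K s)"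

text \<open>The integers modulo \<open>q\<close> are represented by \<open>{0..<int q}\<close>. A chain is given by its coefficients
  with respect to the cells in their reference orientation.\<close>

definition cell_chains :: "('a, 'c) cell_complex \<Rightarrow> nat \<Rightarrow> 'c set \<Rightarrow> nat \<Rightarrow> ('c \<Rightarrow> int) set" where
  "cell_chains K q A j =
     {c. (\<forall>e. c e \<in> {0..<int q}) \<and> (\<forall>e. e \<notin> cells_in K A j \<longrightarrow> c e = 0)}"

text \<open>The boundary map from $(j+1)$-chains to $j$-chains.\<close>

definition boundary :: "('a, 'c) cell_complex \<Rightarrow> nat \<Rightarrow> nat \<Rightarrow> ('c \<Rightarrow> int) \<Rightarrow> 'c \<Rightarrow> int" where
  "boundary K q j c e =
     (if e \<in> cells K j then (\<Sum>s\<in>cells K (Suc j). c s * incidence K s e) mod int q else 0)"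

text \<open>An oriented cell is a pair of a cell and a flag saying whether the orientation is the
  reference one.\<close>

type_synonym 'c oriented = "'c \<times> bool"

definition reverse :: "'c oriented \<Rightarrow> 'c oriented" where
  "reverse x = (fst x, \<not> snd x)"

definition elementary_chain :: "nat \<Rightarrow> 'c oriented \<Rightarrow> 'c \<Rightarrow> int" where
  "elementary_chain q x = (\<lambda>e. if e = fst x then (if snd x then 1 else -1) mod int q else 0)"

text \<open>The relative cochains of \<open>A\<close> modulo \<open>B\<close>, extended by \<open>0\<close> outside the oriented
  \<open>j\<close>-cells of \<open>A\<close>.\<close>

definition rel_cochains ::
    "('a, 'c) cell_complex \<Rightarrow> nat \<Rightarrow> 'c set \<Rightarrow> 'c set \<Rightarrow> nat \<Rightarrow> ('c oriented \<Rightarrow> int) set" where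
  "rel_cochains K q A B j =
     {f. (\<forall>x. f x \<in> {0..<int q}) \<and>
         (\<forall>x. f (reverse x) = (- f x) mod int q) \<and>
         (\<forall>x. fst x \<notin> cells_in K A j \<longrightarrow> f x = 0) \<and>
         (\<forall>x. fst x \<in> cells_in K B j \<longrightarrow> f x = 0)}"

abbreviation cochains :: "('a, 'c) cell_complex \<Rightarrow> nat \<Rightarrow> nat \<Rightarrow> ('c oriented \<Rightarrow> int) set" where
  "cochains K q j \<equiv> rel_cochains K q (cw_cells K) {} j"

definition eval_cochain ::
    "('a, 'c) cell_complex \<Rightarrow> nat \<Rightarrow> nat \<Rightarrow> ('c oriented \<Rightarrow> int) \<Rightarrow> ('c \<Rightarrow> int) \<Rightarrow> int" where
  "eval_cochain K q j f c = (\<Sum>e\<in>cells K j. c e * f (e, True)) mod int q"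

text \<open>The coboundary map from \<open>j\<close>-cochains to $(j+1)$-cochains of a subcomplex \<open>A\<close>.\<close>

definition coboundary ::
    "('a, 'c) cell_complex \<Rightarrow> nat \<Rightarrow> 'c set \<Rightarrow> nat \<Rightarrow> ('c oriented \<Rightarrow> int) \<Rightarrow> 'c oriented \<Rightarrow> int" where
  "coboundary K q A j f x =
     (if fst x \<in> cells_in K A (Suc j)
      then eval_cochain K q j f (boundary K q j (elementary_chain q x)) else 0)"

definition rel_cocycles ::
    "('a, 'c) cell_complex \<Rightarrow> nat \<Rightarrow> 'c set \<Rightarrow> 'c set \<Rightarrow> nat \<Rightarrow> ('c oriented \<Rightarrow> int) set" where
  "rel_cocycles K q A B j = {f \<in> rel_cochains K q A B j. coboundary K q A j f = (\<lambda>x. 0)}"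

definition rel_coboundaries ::
    "('a, 'c) cell_complex \<Rightarrow> nat \<Rightarrow> 'c set \<Rightarrow> 'c set \<Rightarrow> nat \<Rightarrow> ('c oriented \<Rightarrow> int) set" where
  "rel_coboundaries K q A B j =
     (case j of 0 \<Rightarrow> {\<lambda>x. 0} | Suc k \<Rightarrow> coboundary K q A k ` rel_cochains K q A B k)"

definition rel_cohomology ::
    "('a, 'c) cell_complex \<Rightarrow> nat \<Rightarrow> 'c set \<Rightarrow> 'c set \<Rightarrow> nat \<Rightarrow> ('c oriented \<Rightarrow> int) set set" where
  "rel_cohomology K q A B j =
     rel_cocycles K q A B j //
       {(f, g). f \<in> rel_cocycles K q A B j \<and> g \<in> rel_cocycles K q A B j \<and>
                (\<lambda>x. (f x - g x) mod int q) \<in> rel_coboundaries K q A B j}"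

definition normalized_pmf :: "'b set \<Rightarrow> ('b \<Rightarrow> real) \<Rightarrow> 'b pmf" where
  "normalized_pmf S w = embed_pmf (\<lambda>x. if x \<in> S then w x / sum w S else 0)"

lemma pmf_normalized_pmf:
  assumes "finite S" "\<And>x. x \<in> S \<Longrightarrow> w x \<ge> 0" "sum w S > 0"
  shows "pmf (normalized_pmf S w) x = (if x \<in> S then w x / sum w S else 0)"
  unfolding normalized_pmf_def
proof (rule pmf_embed_pmf)
  show "0 \<le> (if x \<in> S then w x / sum w S else 0)" for x
    using assms by simp
  have "(\<integral>\<^sup>+x. ennreal (if x \<in> S then w x / sum w S else 0) \<partial>count_space UNIV)
      = (\<Sum>x\<in>S. ennreal (w x / sum w S))"
    using assms(1) by (subst nn_integral_count_space'[of S]) auto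
  also have "\<dots> = ennreal (\<Sum>x\<in>S. w x / sum w S)"
    using assms by (intro sum_ennreal) auto
  also have "\<dots> = 1"
    using assms(3) by (simp flip: sum_divide_distrib)
  finally show "(\<integral>\<^sup>+x. ennreal (if x \<in> S then w x / sum w S else 0) \<partial>count_space UNIV) = 1" .
qed

definition potts_higgs ::
    "real \<Rightarrow> real \<Rightarrow> nat \<Rightarrow> nat \<Rightarrow> ('a, 'c) cell_complex \<Rightarrow> ('c oriented \<Rightarrow> int) pmf" where
  "potts_higgs \<beta>2 \<beta>1 q i K = normalized_pmf (cochains K q i)
     (\<lambda>f. exp (\<beta>2 * (\<Sum>s\<in>cells K (Suc i). of_bool (coboundary K q (cw_cells K) i f (s, True) = 0))
             + \<beta>1 * (\<Sum>e\<in>cells K i. of_bool (f (e, True) = 0))))"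

definition coupled_percolation ::
    "real \<Rightarrow> real \<Rightarrow> nat \<Rightarrow> nat \<Rightarrow> ('a, 'c) cell_complex \<Rightarrow> ('c set \<times> 'c set) pmf" where
  "coupled_percolation p2 p1 q i K =
     normalized_pmf (percolation_subcomplexes K (Suc i) \<times> percolation_subcomplexes K i)
       (\<lambda>(P2, P1).
          p2 ^ card (cells_in K P2 (Suc i)) *
          (1 - p2) ^ (card (cells K (Suc i)) - card (cells_in K P2 (Suc i))) *
          p1 ^ card (cells_in K P1 i) *
          (1 - p1) ^ (card (cells K i) - card (cells_in K P1 i)) *
          real (card (rel_cohomology K q P2 P1 i)))"

definition wilson ::
    "('a, 'c) cell_complex \<Rightarrow> nat \<Rightarrow> nat \<Rightarrow> ('c \<Rightarrow> int) \<Rightarrow> ('c oriented \<Rightarrow> int) \<Rightarrow> complex" where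
  "wilson K q i \<gamma> f =
     exp (2 * of_real pi * \<i> / of_nat q * of_int (eval_cochain K q i f \<gamma>))"

definition V_event ::
    "('a, 'c) cell_complex \<Rightarrow> nat \<Rightarrow> nat \<Rightarrow> ('c \<Rightarrow> int) \<Rightarrow> ('c set \<times> 'c set) set" where
  "V_event K q i \<gamma> =
     {(P2, P1). \<exists>\<tau> \<in> cell_chains K q P2 (Suc i).
        (\<lambda>e. (\<gamma> e - boundary K q i \<tau> e) mod int q) \<in> cell_chains K q P1 i}"

end

theory Submission
  imports Defs
begin

text \<open>The identity holds because the percolation is the other marginal of a joint law of cochains
  and subcomplexes, as for the Edwards-Sokal coupling of the Potts and random-cluster models.

  Put \<open>p = 1 - exp (- \<beta>)\<close>. Then \<open>exp (\<beta> * of_bool Q) = exp \<beta> * (p * of_bool Q + (1 - p))\<close>.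
  Multiplying such factors over the cells and expanding the product opens each cell with probability
  \<open>p\<close> and demands \<open>Q\<close> at the open cells. For the Higgs weight the demands are that \<open>f\<close>
  vanishes on the \<open>i\<close>-cells of \<open>P1\<close> and \<open>\<delta> f\<close> on the \<open>(i+1)\<close>-cells of \<open>P2\<close>, that is, that \<open>f\<close> is a
  relative cocycle of \<open>(P2, P1)\<close> (\<open>rel_cocycles_percolation\<close>). Hence a sum against the Higgs weight
  is, up to one constant, a Bernoulli-weighted sum over \<open>(P2, P1)\<close> of sums over relative cocycles
  (\<open>sum_higgs_weight\<close>).

  For the partition function the inner sum counts cocycles. Since \<open>P1\<close> contains all cells of
  dimension below \<open>i\<close>, there are no nonzero relative coboundaries, so the count is the order of
  the relative cohomology group (\<open>card_rel_cohomology_percolation\<close>). For the Wilson observable the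
  inner sum is a character sum over the group of cocycles. The cocycles are the annihilator of the
  chains \<open>\<partial> \<tau> + a\<close> with \<open>\<tau>\<close> on \<open>P2\<close> and \<open>a\<close> on \<open>P1\<close>. By Poisson summation
  (\<open>sum_zq_char_annihilator\<close>) the character sum is the number of cocycles if \<open>\<gamma>\<close> is such a
  chain, which is the event \<open>V\<close>, and zero otherwise (\<open>sum_wilson_rel_cocycles\<close>). Dividing the two
  expansions, the constant cancels.\<close>

section \<open>Characters of the integers modulo q\<close>

definition zq_char :: "nat \<Rightarrow> int \<Rightarrow> complex" where
  "zq_char q n = exp (2 * of_real pi * \<i> / of_nat q * of_int n)"

lemma zq_char_0 [simp]: "zq_char q 0 = 1"
  by (simp add: zq_char_def)

lemma zq_char_add: "zq_char q (m + n) = zq_char q m * zq_char q n"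
  by (simp add: zq_char_def exp_add ring_distribs)

lemma zq_char_sum: "zq_char q (sum f A) = (\<Prod>x\<in>A. zq_char q (f x))"
  by (induction A rule: infinite_finite_induct) (simp_all add: zq_char_add)

lemma zq_char_power: "zq_char q (int k * n) = zq_char q n ^ k"
  by (induction k) (simp_all add: zq_char_add ring_distribs)

lemma zq_char_eq_1_iff:
  assumes "q > 0"
  shows "zq_char q n = 1 \<longleftrightarrow> int q dvd n"
proof -
  have "zq_char q n = 1 \<longleftrightarrow> (\<exists>k::int. 2 * pi / real q * real_of_int n = real_of_int (2 * k) * pi)"
    by (simp add: zq_char_def exp_eq_1)
  also have "\<dots> \<longleftrightarrow> (\<exists>k::int. real_of_int n = real_of_int (int q * k))"
    using assms by (intro ex_cong1) (auto simp: field_simps)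
  also have "\<dots> \<longleftrightarrow> int q dvd n"
    by (simp only: of_int_eq_iff dvd_def)
  finally show ?thesis .
qed

lemma zq_char_mod:
  assumes "q > 0"
  shows "zq_char q (n mod int q) = zq_char q n"
proof -
  have "zq_char q (int q * (n div int q)) = 1"
    using assms by (simp add: zq_char_eq_1_iff)
  then show ?thesis
    by (metis mult_div_mod_eq zq_char_add mult_1)
qed

lemma sum_zq_char:
  assumes "q > 0"
  shows "(\<Sum>x\<in>{0..<int q}. zq_char q (x * n)) = (if int q dvd n then of_nat q else 0)"
proof -
  have "(\<Sum>x\<in>{0..<int q}. zq_char q (x * n)) = (\<Sum>k<q. zq_char q (int k * n))"
    by (rule sum.reindex_bij_witness[of _ int nat]) auto
  also have "\<dots> = (\<Sum>k<q. zq_char q n ^ k)"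
    by (simp add: zq_char_power)
  also have "\<dots> = (if int q dvd n then of_nat q else 0)"
  proof (cases "int q dvd n")
    case True
    then have "zq_char q n = 1"
      using assms by (simp add: zq_char_eq_1_iff)
    then show ?thesis
      using True by simp
  next
    case False
    then have "zq_char q n \<noteq> 1"
      using assms by (simp add: zq_char_eq_1_iff)
    moreover have "zq_char q n ^ q = 1"
      using assms by (simp flip: zq_char_power add: zq_char_eq_1_iff)
    ultimately show ?thesis
      using False by (simp add: geometric_sum)
  qed
  finally show ?thesis .
qed

lemma sum_PiE_zq_char:
  assumes "finite A" "q > 0"
  shows "(\<Sum>g\<in>A \<rightarrow>\<^sub>E {0..<int q}. zq_char q (\<Sum>x\<in>A. g x * c x))
       = (if \<forall>x\<in>A. int q dvd c x then of_nat q ^ card A else 0)"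
proof -
  have "(\<Sum>g\<in>A \<rightarrow>\<^sub>E {0..<int q}. zq_char q (\<Sum>x\<in>A. g x * c x))
      = (\<Prod>x\<in>A. \<Sum>y\<in>{0..<int q}. zq_char q (y * c x))"
    using assms by (simp add: zq_char_sum prod_sum_PiE)
  also have "\<dots> = (\<Prod>x\<in>A. if int q dvd c x then of_nat q else 0)"
    by (intro prod.cong refl sum_zq_char assms)
  also have "\<dots> = (if \<forall>x\<in>A. int q dvd c x then of_nat q ^ card A else 0)"
    using assms by (auto simp: prod_zero_iff)
  finally show ?thesis .
qed

text \<open>Poisson summation on a finite abelian group. If \<open>c\<close> is congruent to a combination of the rows
  of \<open>D\<close>, its character is trivial on the annihilator \<open>Z\<close> of the rows. Otherwise, the indicator of
  \<open>Z\<close> is itself an average of characters, over the coefficient vectors \<open>\<tau>\<close> of combinations of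
  rows. Exchanging the two sums leaves, for each \<open>\<tau>\<close>, the sum of one nontrivial character over
  all \<open>g\<close>, which is zero.\<close>
lemma sum_zq_char_annihilator:
  fixes D :: "'s \<Rightarrow> 'e \<Rightarrow> int" and c :: "'e \<Rightarrow> int"
  assumes E: "finite E" and S: "finite S" and q: "q > 0"
  defines "Z \<equiv> {g \<in> E \<rightarrow>\<^sub>E {0..<int q}. \<forall>s\<in>S. int q dvd (\<Sum>e\<in>E. g e * D s e)}"
  shows "(\<Sum>g\<in>Z. zq_char q (\<Sum>e\<in>E. g e * c e))
       = (if \<exists>\<tau>\<in>S \<rightarrow>\<^sub>E {0..<int q}. \<forall>e\<in>E. int q dvd c e - (\<Sum>s\<in>S. \<tau> s * D s e)
          then of_nat (card Z) else 0)"
proof (cases "\<exists>\<tau>\<in>S \<rightarrow>\<^sub>E {0..<int q}. \<forall>e\<in>E. int q dvd c e - (\<Sum>s\<in>S. \<tau> s * D s e)")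
  case True
  then obtain \<tau> where \<tau>: "\<And>e. e \<in> E \<Longrightarrow> int q dvd c e - (\<Sum>s\<in>S. \<tau> s * D s e)"
    by blast
  have "zq_char q (\<Sum>e\<in>E. g e * c e) = 1" if g: "g \<in> Z" for g
  proof -
    have "(\<Sum>e\<in>E. g e * c e)
        = (\<Sum>e\<in>E. g e * (c e - (\<Sum>s\<in>S. \<tau> s * D s e))) + (\<Sum>e\<in>E. \<Sum>s\<in>S. \<tau> s * (g e * D s e))"
      by (simp add: sum_distrib_left mult.left_commute right_diff_distrib flip: sum.distrib)
    also have "(\<Sum>e\<in>E. \<Sum>s\<in>S. \<tau> s * (g e * D s e)) = (\<Sum>s\<in>S. \<tau> s * (\<Sum>e\<in>E. g e * D s e))"
      by (subst sum.swap) (simp add: sum_distrib_left)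
    finally have split: "(\<Sum>e\<in>E. g e * c e)
        = (\<Sum>e\<in>E. g e * (c e - (\<Sum>s\<in>S. \<tau> s * D s e))) + (\<Sum>s\<in>S. \<tau> s * (\<Sum>e\<in>E. g e * D s e))" .
    have "int q dvd (\<Sum>e\<in>E. g e * (c e - (\<Sum>s\<in>S. \<tau> s * D s e)))"
      by (intro dvd_sum dvd_mult \<tau>)
    moreover have "int q dvd (\<Sum>s\<in>S. \<tau> s * (\<Sum>e\<in>E. g e * D s e))"
      using g unfolding Z_def by (intro dvd_sum[of S] dvd_mult) blast
    ultimately have "int q dvd (\<Sum>e\<in>E. g e * c e)"
      unfolding split by (rule dvd_add)
    then show ?thesis
      using q by (simp add: zq_char_eq_1_iff)
  qed
  then show ?thesis
    using True by simp
next
  case False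
  let ?G = "E \<rightarrow>\<^sub>E {0..<int q}" and ?T = "S \<rightarrow>\<^sub>E {0..<int q}"
  have fin: "finite ?G"
    using E by (intro finite_PiE) auto
  \<comment> \<open>The indicator of \<open>Z\<close> is written with negated pairings, so that averaging over \<open>\<tau>\<close> shifts
    \<open>c\<close> by minus the combination of rows.\<close>
  have "of_nat q ^ card S * (\<Sum>g\<in>Z. zq_char q (\<Sum>e\<in>E. g e * c e))
      = (\<Sum>g\<in>?G. zq_char q (\<Sum>e\<in>E. g e * c e) *
           (if \<forall>s\<in>S. int q dvd - (\<Sum>e\<in>E. g e * D s e) then of_nat q ^ card S else 0))"
    unfolding sum_distrib_left Z_def
    by (intro sum.mono_neutral_cong_left fin) auto
  also have "\<dots> = (\<Sum>g\<in>?G. zq_char q (\<Sum>e\<in>E. g e * c e) *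
           (\<Sum>\<tau>\<in>?T. zq_char q (\<Sum>s\<in>S. \<tau> s * - (\<Sum>e\<in>E. g e * D s e))))"
    by (simp only: sum_PiE_zq_char[OF S q])
  also have "\<dots> = (\<Sum>g\<in>?G. \<Sum>\<tau>\<in>?T. zq_char q (\<Sum>e\<in>E. g e * (c e - (\<Sum>s\<in>S. \<tau> s * D s e))))"
  proof -
    have "(\<Sum>e\<in>E. g e * c e) + (\<Sum>s\<in>S. \<tau> s * - (\<Sum>e\<in>E. g e * D s e))
        = (\<Sum>e\<in>E. g e * (c e - (\<Sum>s\<in>S. \<tau> s * D s e)))" for g \<tau>
    proof -
      have "(\<Sum>s\<in>S. \<tau> s * (\<Sum>e\<in>E. g e * D s e)) = (\<Sum>e\<in>E. \<Sum>s\<in>S. \<tau> s * (g e * D s e))"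
        by (subst sum.swap) (simp add: sum_distrib_left)
      then show ?thesis
        by (simp add: sum_negf right_diff_distrib sum_subtractf sum_distrib_left mult.left_commute)
    qed
    then show ?thesis
      by (simp only: sum_distrib_left flip: zq_char_add)
  qed
  also have "\<dots> = (\<Sum>\<tau>\<in>?T. \<Sum>g\<in>?G. zq_char q (\<Sum>e\<in>E. g e * (c e - (\<Sum>s\<in>S. \<tau> s * D s e))))"
    by (rule sum.swap)
  also have "\<dots> = 0"
    using False by (intro sum.neutral) (auto simp: sum_PiE_zq_char[OF E q])
  finally have "(\<Sum>g\<in>Z. zq_char q (\<Sum>e\<in>E. g e * c e)) = 0"
    using q by simp
  then show ?thesis
    using False by (simp only: if_False)
qed

section \<open>Relative cocycles and the topological event\<close>

lemma finite_cells_in: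
  assumes "finite_cell_complex X" "P \<subseteq> cw_cells X"
  shows "finite (cells_in X P j)"
  using assms by (auto simp: finite_cell_complex_def cells_in_def intro: finite_subset)

lemma percolation_subset: "P \<in> percolation_subcomplexes X j \<Longrightarrow> P \<subseteq> cw_cells X"
  by (auto simp: percolation_subcomplexes_def)

lemma cells_in_percolation_below:
  "P \<in> percolation_subcomplexes X j \<Longrightarrow> k < j \<Longrightarrow> cells_in X P k = cells X k"
  by (auto simp: percolation_subcomplexes_def cells_in_def)

text \<open>The boundary of one oriented cell is, up to sign, a row of the incidence matrix, so the
  coboundary pairs \<open>f\<close> with that row. Nested reductions modulo \<open>q\<close> collapse into one.\<close>
lemma coboundary_eq:
  assumes "finite_cell_complex X" "P \<subseteq> cw_cells X"
  shows "coboundary X q P i f (s, b)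
       = (if s \<in> cells_in X P (Suc i)
          then ((if b then 1 else -1) * (\<Sum>e\<in>cells X i. f (e, True) * incidence X s e)) mod int q
          else 0)"
proof (cases "s \<in> cells_in X P (Suc i)")
  case True
  then have s: "s \<in> cells X (Suc i)"
    using assms(2) by (auto simp: cells_in_def)
  have fin: "finite (cells X (Suc i))"
    using assms(1) by (rule finite_cells_in) simp
  let ?o = "if b then 1 else -1 :: int"
  have bd: "boundary X q i (elementary_chain q (s, b)) e = (?o * incidence X s e) mod int q"
    if "e \<in> cells X i" for e
  proof -
    have "(\<Sum>s'\<in>cells X (Suc i). elementary_chain q (s, b) s' * incidence X s' e)
        = (?o mod int q) * incidence X s e"
      using sum.delta'[OF fin, of s "\<lambda>s'. (?o mod int q) * incidence X s' e"] s
      by (simp add: elementary_chain_def if_distrib[where f = "\<lambda>x. x * _"] eq_commute[of s] cong: if_cong)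
    then show ?thesis
      using that by (simp add: boundary_def mod_mult_left_eq)
  qed
  have "coboundary X q P i f (s, b)
      = (\<Sum>e\<in>cells X i. (?o * incidence X s e) mod int q * f (e, True)) mod int q"
    using True by (simp add: coboundary_def eval_cochain_def bd)
  also have "\<dots> = (\<Sum>e\<in>cells X i. ?o * incidence X s e * f (e, True)) mod int q"
    by (subst (1 2) mod_sum_eq[symmetric]) (simp add: mod_mult_left_eq)
  also have "\<dots> = (?o * (\<Sum>e\<in>cells X i. f (e, True) * incidence X s e)) mod int q"
    by (simp add: sum_distrib_left mult_ac)
  finally show ?thesis
    using True by simp
qed (simp add: coboundary_def)

text \<open>A percolation subcomplex of dimension \<open>i + 1\<close> contains every \<open>i\<close>-cell. So its \<open>i\<close>-cochains are
  those of the whole complex, and each condition refers to a single open cell. Antisymmetry makes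
  it enough to test one orientation of each cell.\<close>
lemma rel_cocycles_percolation:
  assumes X: "finite_cell_complex X"
    and P2: "P2 \<in> percolation_subcomplexes X (Suc i)"
    and P1: "P1 \<in> percolation_subcomplexes X i"
  shows "rel_cocycles X q P2 P1 i
       = {f \<in> cochains X q i.
            (\<forall>e\<in>cells_in X P1 i. f (e, True) = 0) \<and>
            (\<forall>s\<in>cells_in X P2 (Suc i). coboundary X q (cw_cells X) i f (s, True) = 0)}"
proof -
  have sub: "P2 \<subseteq> cw_cells X"
    using P2 by (rule percolation_subset)
  have P2i: "cells_in X P2 i = cells X i"
    using P2 by (rule cells_in_percolation_below) simp
  have empty: "cells_in X {} i = {}"
    by (simp add: cells_in_def)
  have cochains: "f \<in> rel_cochains X q P2 P1 i \<longleftrightarrow>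
      f \<in> cochains X q i \<and> (\<forall>e\<in>cells_in X P1 i. f (e, True) = 0)" for f
  proof -
    have "f (e, False) = 0" if "f (e, True) = 0" "\<forall>x. f (reverse x) = (- f x) mod int q" for e
      using spec[OF that(2), of "(e, True)"] that(1) by (simp add: reverse_def)
    then have "(\<forall>x. fst x \<in> cells_in X P1 i \<longrightarrow> f x = 0) \<longleftrightarrow> (\<forall>e\<in>cells_in X P1 i. f (e, True) = 0)"
      if "\<forall>x. f (reverse x) = (- f x) mod int q"
      using that by (metis (full_types) fst_conv prod.collapse)
    then show ?thesis
      by (auto simp: rel_cochains_def P2i empty)
  qed
  have cocycle: "coboundary X q P2 i f = (\<lambda>x. 0) \<longleftrightarrow>
      (\<forall>s\<in>cells_in X P2 (Suc i). coboundary X q (cw_cells X) i f (s, True) = 0)" for f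
  proof -
    have "coboundary X q (cw_cells X) i f (s, True) = coboundary X q P2 i f (s, True)"
      if "s \<in> cells_in X P2 (Suc i)" for s
      using that sub by (auto simp: coboundary_def cells_in_def)
    moreover have "coboundary X q P2 i f (s, b) = 0"
      if "s \<in> cells_in X P2 (Suc i) \<longrightarrow> coboundary X q P2 i f (s, True) = 0" for s b
      using that by (auto simp: coboundary_eq[OF X sub] simp flip: dvd_eq_mod_eq_0)
    ultimately show ?thesis
      by (auto simp: fun_eq_iff)
  qed
  show ?thesis
    by (auto simp: rel_cocycles_def cochains cocycle)
qed

text \<open>For \<open>i > 0\<close>, all \<open>(i-1)\<close>-cells belong to \<open>P1\<close>, so the only relative \<open>(i-1)\<close>-cochain is zero.\<close>
lemma rel_coboundaries_percolation:
  assumes P1: "P1 \<in> percolation_subcomplexes X i" and P2: "P2 \<subseteq> cw_cells X" and q: "q > 0"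
  shows "rel_coboundaries X q P2 P1 i = {\<lambda>x. 0}"
proof (cases i)
  case 0
  then show ?thesis by (simp add: rel_coboundaries_def)
next
  case (Suc k)
  have "cells_in X P2 k \<subseteq> cells_in X P1 k"
    using P2 cells_in_percolation_below[OF P1, of k] Suc by (auto simp: cells_in_def)
  then have zero: "f x = 0" if "f \<in> rel_cochains X q P2 P1 k" for f x
    using that unfolding rel_cochains_def by blast
  have "(\<lambda>x. 0) \<in> rel_cochains X q P2 P1 k"
    using q by (simp add: rel_cochains_def)
  with zero have "rel_cochains X q P2 P1 k = {\<lambda>x. 0}"
    by blast
  moreover have "coboundary X q P2 k (\<lambda>x. 0) = (\<lambda>x. 0)"
    by (auto simp: coboundary_def eval_cochain_def fun_eq_iff)
  ultimately show ?thesis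
    using Suc by (auto simp: rel_coboundaries_def)
qed

text \<open>Values are canonical residues and the only coboundary is zero, so cohomologous cocycles are
  equal and every cohomology class is a singleton.\<close>
lemma card_rel_cohomology_percolation:
  assumes P1: "P1 \<in> percolation_subcomplexes X i" and P2: "P2 \<subseteq> cw_cells X" and q: "q > 0"
  shows "card (rel_cohomology X q P2 P1 i) = card (rel_cocycles X q P2 P1 i)"
proof -
  let ?Z = "rel_cocycles X q P2 P1 i"
  have bd: "rel_coboundaries X q P2 P1 i = {\<lambda>x. 0}"
    using P1 P2 q by (rule rel_coboundaries_percolation)
  have eq: "f = g" if "f \<in> ?Z" "g \<in> ?Z" "(\<lambda>x. (f x - g x) mod int q) = (\<lambda>x. 0)" for f g
  proof
    fix x
    have "f x \<in> {0..<int q}" "g x \<in> {0..<int q}"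
      using that unfolding rel_cocycles_def rel_cochains_def by blast+
    moreover have "int q dvd f x - g x"
      using fun_cong[OF that(3), of x] by (simp add: dvd_eq_mod_eq_0)
    ultimately show "f x = g x"
      by (simp add: mod_eq_dvd_iff[symmetric])
  qed
  have "rel_cohomology X q P2 P1 i = ?Z // Id_on ?Z"
    unfolding rel_cohomology_def bd
    by (rule arg_cong[where f = "\<lambda>r. ?Z // r"]) (auto simp: Id_on_def dest: eq)
  also have "\<dots> = (\<lambda>f. {f}) ` ?Z"
    by (auto simp: quotient_def)
  finally show ?thesis
    by (simp add: card_image)
qed

text \<open>Passing to values on reference orientations identifies cochains vanishing on \<open>P\<close> with arbitrary
  residue-valued functions on the remaining cells, which brings character sums over cochains into product form.\<close>
lemma bij_betw_rel_cochains:
  fixes X :: "('a, 'c) cell_complex"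
  assumes "q > 0"
  shows "bij_betw (\<lambda>f. restrict (\<lambda>e. f (e, True)) (cells X i - cells_in X P i))
           (rel_cochains X q (cw_cells X) P i)
           ((cells X i - cells_in X P i) \<rightarrow>\<^sub>E {0..<int q})"
  (is "bij_betw ?r ?C (?E \<rightarrow>\<^sub>E _)")
proof (rule bij_betw_byWitness[where f' = "\<lambda>g (e, b). if e \<in> ?E then ((if b then 1 else -1) * g e) mod int q else 0"])
  let ?x = "\<lambda>g (e, b). if e \<in> ?E then ((if b then 1 else -1) * g e) mod int q else 0"
  show "\<forall>f\<in>?C. ?x (?r f) = f"
  proof (intro ballI ext)
    fix f :: "'c oriented \<Rightarrow> int" and x :: "'c oriented" assume f: "f \<in> ?C"
    obtain e b where x: "x = (e, b)"
      by (rule prod.exhaust)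
    have "f (reverse (e, True)) = (- f (e, True)) mod int q"
      using f unfolding rel_cochains_def by blast
    then have "f (e, False) = (- f (e, True)) mod int q"
      by (simp add: reverse_def)
    moreover have "f (e, True) \<in> {0..<int q}"
      using f unfolding rel_cochains_def by blast
    moreover have "f (e, b) = 0" if "e \<notin> ?E"
      using f that unfolding rel_cochains_def by (cases "e \<in> cells X i") simp_all
    ultimately show "?x (?r f) x = f x"
      unfolding x by (cases "e \<in> ?E"; cases b) simp_all
  qed
  show "\<forall>g\<in>?E \<rightarrow>\<^sub>E {0..<int q}. ?r (?x g) = g"
  proof (intro ballI ext)
    fix g e assume g: "g \<in> ?E \<rightarrow>\<^sub>E {0..<int q}"
    show "?r (?x g) e = g e"
    proof (cases "e \<in> ?E")
      case True
      then have "g e \<in> {0..<int q}"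
        using g by (rule PiE_mem[rotated])
      then show ?thesis
        using True by simp
    next
      case False
      then show ?thesis
        by (simp only: restrict_apply False if_False PiE_arb[OF g False])
    qed
  qed
  show "?r ` ?C \<subseteq> ?E \<rightarrow>\<^sub>E {0..<int q}"
    unfolding rel_cochains_def restrict_PiE_iff image_subset_iff by blast
  show "?x ` (?E \<rightarrow>\<^sub>E {0..<int q}) \<subseteq> ?C"
  proof (rule image_subsetI)
    fix g :: "'c \<Rightarrow> int"
    have "?x g (reverse x) = (- ?x g x) mod int q" for x
      by (simp add: reverse_def mod_minus_eq case_prod_unfold)
    moreover have "?x g x \<in> {0..<int q}" for x
      using assms by (cases x) simp
    moreover have "?x g x = 0" if "fst x \<notin> ?E" for x
      by (simp only: case_prod_unfold that if_False)
    ultimately show "?x g \<in> ?C"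
      unfolding rel_cochains_def by blast
  qed
qed

lemma finite_cochains:
  assumes "finite_cell_complex X" "q > 0"
  shows "finite (cochains X q i)"
proof -
  have "finite ((cells X i - cells_in X {} i) \<rightarrow>\<^sub>E {0..<int q})"
    using finite_cells_in[OF assms(1), of "cw_cells X" i] by (intro finite_PiE) auto
  then show ?thesis
    using bij_betw_finite[OF bij_betw_rel_cochains[OF assms(2), of X i "{}"]] by simp
qed

text \<open>In terms of incidence numbers, \<open>V\<close> says that \<open>\<gamma>\<close> is congruent, off \<open>P1\<close>, to a combination
  of the boundaries of the \<open>(i+1)\<close>-cells of \<open>P2\<close>: the solvability condition of
  \<open>sum_zq_char_annihilator\<close> for the incidence matrix.\<close>
lemma V_event_iff:
  assumes X: "finite_cell_complex X" and P2: "P2 \<subseteq> cw_cells X"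
    and q: "q > 0" and \<gamma>: "\<gamma> \<in> cell_chains X q (cw_cells X) i"
  shows "(P2, P1) \<in> V_event X q i \<gamma> \<longleftrightarrow>
    (\<exists>\<tau>\<in>cells_in X P2 (Suc i) \<rightarrow>\<^sub>E {0..<int q}. \<forall>e\<in>cells X i - cells_in X P1 i.
       int q dvd \<gamma> e - (\<Sum>s\<in>cells_in X P2 (Suc i). \<tau> s * incidence X s e))"
  (is "_ \<longleftrightarrow> (\<exists>\<tau>\<in>?S \<rightarrow>\<^sub>E _. ?Q \<tau>)")
proof -
  have S: "?S \<subseteq> cells X (Suc i)"
    using P2 by (auto simp: cells_in_def)
  have fin: "finite (cells X (Suc i))"
    using X by (rule finite_cells_in) simp
  have supp: "(\<lambda>e. (\<gamma> e - boundary X q i \<tau> e) mod int q) \<in> cell_chains X q P1 i \<longleftrightarrow> ?Q \<tau>"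
    if \<tau>: "\<tau> \<in> cell_chains X q P2 (Suc i)" for \<tau>
  proof -
    have "(\<Sum>s\<in>cells X (Suc i). \<tau> s * incidence X s e) = (\<Sum>s\<in>?S. \<tau> s * incidence X s e)" for e
      using \<tau> S by (intro sum.mono_neutral_right fin) (auto simp: cell_chains_def)
    then have "(\<gamma> e - boundary X q i \<tau> e) mod int q
        = (if e \<in> cells X i then (\<gamma> e - (\<Sum>s\<in>?S. \<tau> s * incidence X s e)) mod int q else 0)" for e
      using \<gamma> by (auto simp: boundary_def cell_chains_def mod_diff_right_eq)
    then show ?thesis
      using q by (auto simp: cell_chains_def dvd_eq_mod_eq_0)
  qed
  show ?thesis
  proof
    assume "(P2, P1) \<in> V_event X q i \<gamma>"
    then obtain \<tau> where \<tau>: "\<tau> \<in> cell_chains X q P2 (Suc i)" "?Q \<tau>"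
      using supp by (auto simp: V_event_def)
    then show "\<exists>\<tau>\<in>?S \<rightarrow>\<^sub>E {0..<int q}. ?Q \<tau>"
      by (intro bexI[of _ "restrict \<tau> ?S"]) (auto simp: cell_chains_def)
  next
    assume "\<exists>\<tau>\<in>?S \<rightarrow>\<^sub>E {0..<int q}. ?Q \<tau>"
    then obtain \<tau> where \<tau>: "\<tau> \<in> ?S \<rightarrow>\<^sub>E {0..<int q}" "?Q \<tau>"
      by blast
    define \<tau>' where "\<tau>' = (\<lambda>s. if s \<in> ?S then \<tau> s else 0)"
    have "\<tau>' \<in> cell_chains X q P2 (Suc i)"
      using \<tau>(1) q by (auto simp: \<tau>'_def cell_chains_def)
    moreover have "?Q \<tau>'"
      using \<tau>(2) by (simp add: \<tau>'_def)
    ultimately show "(P2, P1) \<in> V_event X q i \<gamma>"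
      using supp by (auto simp: V_event_def)
  qed
qed

text \<open>The coboundary is the transpose of the boundary. So on reference orientations the cocycles are
  the annihilator of the rows of the incidence matrix restricted to the \<open>(i+1)\<close>-cells of \<open>P2\<close> and
  the \<open>i\<close>-cells outside \<open>P1\<close>, and Poisson summation applies with \<open>\<gamma>\<close> as the tested chain.\<close>
lemma sum_wilson_rel_cocycles:
  fixes X :: "('a, 'c) cell_complex"
  assumes X: "finite_cell_complex X" and q: "q > 0"
    and \<gamma>: "\<gamma> \<in> cell_chains X q (cw_cells X) i"
    and P2: "P2 \<in> percolation_subcomplexes X (Suc i)"
    and P1: "P1 \<in> percolation_subcomplexes X i"
  shows "(\<Sum>f\<in>rel_cocycles X q P2 P1 i. wilson X q i \<gamma> f)
       = of_nat (card (rel_cocycles X q P2 P1 i)) * indicator (V_event X q i \<gamma>) (P2, P1)"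
proof -
  define E where "E = cells X i - cells_in X P1 i"
  define S where "S = cells_in X P2 (Suc i)"
  define r :: "('c oriented \<Rightarrow> int) \<Rightarrow> 'c \<Rightarrow> int" where "r = (\<lambda>f. restrict (\<lambda>e. f (e, True)) E)"
  define Z where "Z = {g \<in> E \<rightarrow>\<^sub>E {0..<int q}. \<forall>s\<in>S. int q dvd (\<Sum>e\<in>E. g e * incidence X s e)}"
  have sub: "P2 \<subseteq> cw_cells X"
    using P2 by (rule percolation_subset)
  have SX: "S \<subseteq> cells X (Suc i)"
    using sub by (auto simp: S_def cells_in_def)
  have fin: "finite (cells X i)" "finite E" "finite S"
    using finite_cells_in[OF X] sub by (auto simp: E_def S_def)
  let ?C = "rel_cochains X q (cw_cells X) P1 i"
  have sum_r: "(\<Sum>e\<in>cells X i. f (e, True) * d e) = (\<Sum>e\<in>E. r f e * d e)" if "f \<in> ?C" for f d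
    using that by (intro sum.mono_neutral_cong_right fin) (auto simp: E_def r_def rel_cochains_def)
  have Z_eq: "rel_cocycles X q P2 P1 i = {f \<in> ?C. r f \<in> Z}"
  proof -
    have bij: "r f \<in> E \<rightarrow>\<^sub>E {0..<int q}" if "f \<in> ?C" for f
      using bij_betw_apply[OF bij_betw_rel_cochains[OF q]] that unfolding r_def E_def by fast
    have "cells_in X P2 i = cells X i"
      using P2 by (rule cells_in_percolation_below) simp
    then have "rel_cochains X q P2 P1 i = ?C"
      by (simp add: rel_cochains_def)
    moreover have "coboundary X q P2 i f = (\<lambda>x. 0) \<longleftrightarrow> r f \<in> Z" if f: "f \<in> ?C" for f
      using bij[OF f] by (auto simp: fun_eq_iff coboundary_eq[OF X sub] sum_r[OF f] Z_def S_def
          simp flip: dvd_eq_mod_eq_0)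
    ultimately show ?thesis
      by (auto simp: rel_cocycles_def)
  qed
  have bij: "bij_betw r (rel_cocycles X q P2 P1 i) Z"
  proof -
    have *: "bij_betw r ?C (E \<rightarrow>\<^sub>E {0..<int q})"
      unfolding r_def E_def by (rule bij_betw_rel_cochains[OF q])
    have "r ` rel_cocycles X q P2 P1 i = Z"
      using bij_betw_imp_surj_on[OF *] by (auto simp: Z_eq Z_def image_iff)
    then show ?thesis
      using * by (auto simp: Z_eq bij_betw_def intro: inj_on_subset)
  qed
  have "(\<Sum>f\<in>rel_cocycles X q P2 P1 i. wilson X q i \<gamma> f)
      = (\<Sum>f\<in>rel_cocycles X q P2 P1 i. zq_char q (\<Sum>e\<in>E. r f e * \<gamma> e))"
  proof (rule sum.cong)
    fix f assume "f \<in> rel_cocycles X q P2 P1 i"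
    then have "(\<Sum>e\<in>cells X i. f (e, True) * \<gamma> e) = (\<Sum>e\<in>E. r f e * \<gamma> e)"
      by (intro sum_r) (simp add: Z_eq)
    moreover have "wilson X q i \<gamma> f = zq_char q ((\<Sum>e\<in>cells X i. f (e, True) * \<gamma> e) mod int q)"
      by (simp add: wilson_def zq_char_def eval_cochain_def mult.commute)
    ultimately show "wilson X q i \<gamma> f = zq_char q (\<Sum>e\<in>E. r f e * \<gamma> e)"
      by (simp add: zq_char_mod[OF q])
  qed simp
  also have "\<dots> = (\<Sum>g\<in>Z. zq_char q (\<Sum>e\<in>E. g e * \<gamma> e))"
    by (rule sum.reindex_bij_betw[OF bij])
  also have "\<dots> = of_nat (card Z) * indicator (V_event X q i \<gamma>) (P2, P1)"
    unfolding Z_def sum_zq_char_annihilator[OF fin(2,3) q]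
    using V_event_iff[OF X sub q \<gamma>, of P1] by (simp add: E_def S_def indicator_def)
  also have "card Z = card (rel_cocycles X q P2 P1 i)"
    using bij_betw_same_card[OF bij] by simp
  finally show ?thesis .
qed

section \<open>The Edwards-Sokal expansion\<close>

text \<open>The top cells of a percolation subcomplex are free: the boundary of a cell lies in open cells of
  lower dimension, so adding any set of \<open>j\<close>-cells to the lower skeleton gives a subcomplex.\<close>
lemma bij_betw_percolation_subcomplexes:
  assumes "finite_cell_complex X"
  shows "bij_betw (\<lambda>P. cells_in X P j) (percolation_subcomplexes X j) (Pow (cells X j))"
proof (rule bij_betw_byWitness[where f' = "\<lambda>S. S \<union> {e \<in> cw_cells X. cw_dim X e < j}"])
  show "(\<lambda>S. S \<union> {e \<in> cw_cells X. cw_dim X e < j}) ` Pow (cells X j) \<subseteq> percolation_subcomplexes X j"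
  proof safe
    fix S assume S: "S \<subseteq> cells X j"
    let ?P = "S \<union> {e \<in> cw_cells X. cw_dim X e < j}"
    have "closed_cell X e \<subseteq> (\<Union>e'\<in>?P. open_cell X e')" if e: "e \<in> ?P" for e
    proof -
      have "e \<in> cw_cells X" "cw_dim X e \<le> j"
        using e S by (auto simp: cells_in_def)
      have "closed_cell X e \<subseteq> open_cell X e \<union>
          cw_char X e ` (topspace (closed_disc (cw_dim X e)) - open_disc (cw_dim X e))"
        by (auto simp: closed_cell_def open_cell_def)
      also have "\<dots> \<subseteq> open_cell X e \<union>
          (\<Union>e'\<in>{e'\<in>cw_cells X. cw_dim X e' < cw_dim X e}. open_cell X e')"
        using assms \<open>e \<in> cw_cells X\<close> unfolding finite_cell_complex_def by blast
      also have "\<dots> \<subseteq> (\<Union>e'\<in>?P. open_cell X e')"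
        using e \<open>cw_dim X e \<le> j\<close> by fastforce
      finally show ?thesis .
    qed
    then show "?P \<in> percolation_subcomplexes X j"
      using S unfolding percolation_subcomplexes_def subcomplex_def by (auto simp: cells_in_def)
  qed
qed (auto simp: percolation_subcomplexes_def cells_in_def le_less)

lemma finite_percolation_subcomplexes:
  "finite_cell_complex X \<Longrightarrow> finite (percolation_subcomplexes X j)"
  using bij_betw_finite[OF bij_betw_percolation_subcomplexes, of X j] finite_cells_in[of X "cw_cells X" j]
  by simp

text \<open>The sets \<open>S\<close> record from which factors
  \<open>exp (\<beta> * of_bool (Q s)) = exp \<beta> * ((1 - exp (- \<beta>)) * of_bool (Q s) + exp (- \<beta>))\<close> the summand
  with \<open>of_bool (Q s)\<close> is taken.\<close>
lemma exp_sum_of_bool_expansion: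
  fixes \<beta> :: real
  assumes "finite N"
  shows "exp (\<beta> * (\<Sum>s\<in>N. of_bool (Q s)))
       = exp (\<beta> * card N) * (\<Sum>S\<in>Pow N. (1 - exp (- \<beta>)) ^ card S *
           (1 - (1 - exp (- \<beta>))) ^ (card N - card S) * of_bool (\<forall>s\<in>S. Q s))"
proof -
  let ?p = "1 - exp (- \<beta>)"
  have "exp (\<beta> * (\<Sum>s\<in>N. of_bool (Q s))) = (\<Prod>s\<in>N. exp (\<beta> * of_bool (Q s)))"
    unfolding sum_distrib_left by (rule exp_sum[OF assms])
  also have "\<dots> = (\<Prod>s\<in>N. exp \<beta> * (?p * of_bool (Q s) + (1 - ?p)))"
    by (intro prod.cong) (auto simp: exp_minus)
  also have "\<dots> = exp (\<beta> * card N) * (\<Prod>s\<in>N. ?p * of_bool (Q s) + (1 - ?p))"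
    by (simp add: prod.distrib exp_of_nat_mult mult.commute[of \<beta>])
  also have "(\<Prod>s\<in>N. ?p * of_bool (Q s) + (1 - ?p))
      = (\<Sum>S\<in>Pow N. ?p ^ card S * (1 - ?p) ^ (card N - card S) * of_bool (\<forall>s\<in>S. Q s))"
    unfolding prod_add[OF assms]
  proof (rule sum.cong)
    fix S assume "S \<in> Pow N"
    then have S: "S \<subseteq> N" "finite S"
      using assms by (auto intro: finite_subset)
    have "(\<Prod>s\<in>S. of_bool (Q s)) = (of_bool (\<forall>s\<in>S. Q s) :: real)"
      using S(2) by (induction S) auto
    then show "(\<Prod>s\<in>S. ?p * of_bool (Q s)) * (\<Prod>s\<in>N - S. 1 - ?p)
        = ?p ^ card S * (1 - ?p) ^ (card N - card S) * of_bool (\<forall>s\<in>S. Q s)"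
      using S by (simp add: prod.distrib card_Diff_subset)
  qed simp
  finally show ?thesis .
qed

definition bernoulli_weight :: "('a, 'c) cell_complex \<Rightarrow> real \<Rightarrow> nat \<Rightarrow> 'c set \<Rightarrow> real" where
  "bernoulli_weight X p j P = p ^ card (cells_in X P j) * (1 - p) ^ (card (cells X j) - card (cells_in X P j))"

lemma exp_sum_of_bool_percolation:
  fixes \<beta> :: real
  assumes "finite_cell_complex X"
  shows "exp (\<beta> * (\<Sum>s\<in>cells X j. of_bool (Q s)))
       = exp (\<beta> * card (cells X j)) *
         (\<Sum>P\<in>percolation_subcomplexes X j. bernoulli_weight X (1 - exp (- \<beta>)) j P * of_bool (\<forall>s\<in>cells_in X P j. Q s))"
  unfolding exp_sum_of_bool_expansion[OF finite_cells_in[OF assms subset_refl]] bernoulli_weight_def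
  by (subst sum.reindex_bij_betw[OF bij_betw_percolation_subcomplexes[OF assms], symmetric]) simp

definition higgs_weight :: "('a, 'c) cell_complex \<Rightarrow> real \<Rightarrow> real \<Rightarrow> nat \<Rightarrow> nat \<Rightarrow> ('c oriented \<Rightarrow> int) \<Rightarrow> real" where
  "higgs_weight X \<beta>2 \<beta>1 q i f =
     exp (\<beta>2 * (\<Sum>s\<in>cells X (Suc i). of_bool (coboundary X q (cw_cells X) i f (s, True) = 0))
             + \<beta>1 * (\<Sum>e\<in>cells X i. of_bool (f (e, True) = 0)))"

text \<open>The expansion is stated for an arbitrary observable \<open>h\<close> because both the partition function
  (\<open>h = 1\<close>) and the numerator of the Wilson expectation are needed.\<close>
lemma sum_higgs_weight:
  fixes h :: "('c oriented \<Rightarrow> int) \<Rightarrow> complex"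
  assumes X: "finite_cell_complex X" and q: "q > 0"
  shows "(\<Sum>f\<in>cochains X q i. of_real (higgs_weight X \<beta>2 \<beta>1 q i f) * h f)
       = of_real (exp (\<beta>2 * card (cells X (Suc i)) + \<beta>1 * card (cells X i))) *
         (\<Sum>(P2, P1)\<in>percolation_subcomplexes X (Suc i) \<times> percolation_subcomplexes X i.
            of_real (bernoulli_weight X (1 - exp (- \<beta>2)) (Suc i) P2 *
                     bernoulli_weight X (1 - exp (- \<beta>1)) i P1) *
            (\<Sum>f\<in>rel_cocycles X q P2 P1 i. h f))"
proof -
  let ?R2 = "percolation_subcomplexes X (Suc i)" and ?R1 = "percolation_subcomplexes X i"
  let ?b2 = "bernoulli_weight X (1 - exp (- \<beta>2)) (Suc i)" and ?b1 = "bernoulli_weight X (1 - exp (- \<beta>1)) i"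
  let ?C = "exp (\<beta>2 * card (cells X (Suc i)) + \<beta>1 * card (cells X i))"
  have w: "higgs_weight X \<beta>2 \<beta>1 q i f = ?C *
      (\<Sum>(P2, P1)\<in>?R2 \<times> ?R1. ?b2 P2 * ?b1 P1 * of_bool (f \<in> rel_cocycles X q P2 P1 i))"
    if f: "f \<in> cochains X q i" for f
  proof -
    have "higgs_weight X \<beta>2 \<beta>1 q i f = ?C *
      ((\<Sum>P2\<in>?R2. ?b2 P2 * of_bool (\<forall>s\<in>cells_in X P2 (Suc i). coboundary X q (cw_cells X) i f (s, True) = 0)) *
       (\<Sum>P1\<in>?R1. ?b1 P1 * of_bool (\<forall>e\<in>cells_in X P1 i. f (e, True) = 0)))"
      by (simp only: higgs_weight_def exp_add exp_sum_of_bool_percolation[OF X] mult_ac)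
    also have "\<dots> = ?C *
      (\<Sum>(P2, P1)\<in>?R2 \<times> ?R1. ?b2 P2 * ?b1 P1 * of_bool (f \<in> rel_cocycles X q P2 P1 i))"
      unfolding sum_product sum.cartesian_product
      using f by (intro arg_cong[where f = "(*) _"] sum.cong) (auto simp: rel_cocycles_percolation[OF X])
    finally show ?thesis .
  qed
  have of_bool: "complex_of_real (of_bool P) = of_bool P" for P
    by (cases P) simp_all
  have "(\<Sum>f\<in>cochains X q i. of_real (higgs_weight X \<beta>2 \<beta>1 q i f) * h f)
      = (\<Sum>f\<in>cochains X q i. \<Sum>(P2, P1)\<in>?R2 \<times> ?R1.
           of_real ?C * (of_real (?b2 P2 * ?b1 P1) * (of_bool (f \<in> rel_cocycles X q P2 P1 i) * h f)))"
    by (intro sum.cong) (simp_all add: w sum_distrib_left sum_distrib_right case_prod_unfold of_bool mult_ac)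
  also have "\<dots> = (\<Sum>(P2, P1)\<in>?R2 \<times> ?R1. \<Sum>f\<in>cochains X q i.
           of_real ?C * (of_real (?b2 P2 * ?b1 P1) * (of_bool (f \<in> rel_cocycles X q P2 P1 i) * h f)))"
    by (subst sum.swap) (simp add: case_prod_unfold)
  also have "\<dots> = (\<Sum>(P2, P1)\<in>?R2 \<times> ?R1.
           of_real ?C * (of_real (?b2 P2 * ?b1 P1) * (\<Sum>f\<in>rel_cocycles X q P2 P1 i. h f)))"
  proof (intro sum.cong refl, clarify)
    fix P2 P1 assume P: "P2 \<in> ?R2" "P1 \<in> ?R1"
    have "(\<Sum>f\<in>cochains X q i. of_bool (f \<in> rel_cocycles X q P2 P1 i) * h f)
        = (\<Sum>f\<in>rel_cocycles X q P2 P1 i. h f)"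
      using P by (intro sum.mono_neutral_cong_right finite_cochains[OF X q])
        (auto simp: rel_cocycles_percolation[OF X])
    then show "(\<Sum>f\<in>cochains X q i. of_real ?C * (of_real (?b2 P2 * ?b1 P1) *
             (of_bool (f \<in> rel_cocycles X q P2 P1 i) * h f)))
        = of_real ?C * (of_real (?b2 P2 * ?b1 P1) * (\<Sum>f\<in>rel_cocycles X q P2 P1 i. h f))"
      by (simp only: flip: sum_distrib_left)
  qed
  also have "\<dots> = of_real ?C * (\<Sum>(P2, P1)\<in>?R2 \<times> ?R1.
            of_real (?b2 P2 * ?b1 P1) * (\<Sum>f\<in>rel_cocycles X q P2 P1 i. h f))"
    by (simp only: sum_distrib_left[of _ _ "?R2 \<times> ?R1"] case_prod_unfold)
  finally show ?thesis .
qed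

section \<open>Comparison of the two measures\<close>

lemma expectation_normalized_pmf:
  fixes h :: "'b \<Rightarrow> 'v :: {banach, second_countable_topology}"
  assumes "finite S" "\<And>x. x \<in> S \<Longrightarrow> w x \<ge> 0" "sum w S > 0"
  shows "measure_pmf.expectation (normalized_pmf S w) h = (\<Sum>x\<in>S. (w x / sum w S) *\<^sub>R h x)"
proof -
  have pmf: "pmf (normalized_pmf S w) x = (if x \<in> S then w x / sum w S else 0)" for x
    using assms by (rule pmf_normalized_pmf)
  have "measure_pmf.expectation (normalized_pmf S w) h = (\<Sum>x\<in>S. pmf (normalized_pmf S w) x *\<^sub>R h x)"
  proof (rule integral_measure_pmf[OF assms(1)])
    fix x assume "x \<in> set_pmf (normalized_pmf S w)"
    then show "x \<in> S"
      by (rule contrapos_pp) (simp add: set_pmf_iff pmf)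
  qed
  then show ?thesis
    by (simp add: pmf)
qed

theorem theorem7:
  fixes X :: "('a, 'c) cell_complex"
    and q i :: nat
    and \<beta>2 \<beta>1 :: real
    and \<gamma> :: "'c \<Rightarrow> int"
  assumes "finite_cell_complex X"
    and "prime q"
    and "\<beta>2 \<ge> 0" and "\<beta>1 \<ge> 0"
    and "\<gamma> \<in> cell_chains X q (cw_cells X) i"
  shows "measure_pmf.expectation (potts_higgs \<beta>2 \<beta>1 q i X) (wilson X q i \<gamma>)
       = complex_of_real (measure_pmf.prob
           (coupled_percolation (1 - exp (- \<beta>2)) (1 - exp (- \<beta>1)) q i X) (V_event X q i \<gamma>))"
proof -
  note X = assms(1) and \<gamma> = assms(5)
  have q: "q > 0"
    using assms(2) by (rule prime_gt_0_nat)
  define F where "F = cochains X q i"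
  define R where "R = percolation_subcomplexes X (Suc i) \<times> percolation_subcomplexes X i"
  define w where "w = higgs_weight X \<beta>2 \<beta>1 q i"
  define b where "b = (\<lambda>(P2, P1). bernoulli_weight X (1 - exp (- \<beta>2)) (Suc i) P2 *
                                   bernoulli_weight X (1 - exp (- \<beta>1)) i P1)"
  define v where "v = (\<lambda>(P2, P1). b (P2, P1) * real (card (rel_cohomology X q P2 P1 i)))"
  define C where "C = exp (\<beta>2 * card (cells X (Suc i)) + \<beta>1 * card (cells X i))"
  let ?V = "V_event X q i \<gamma>"
  have fin: "finite F" "finite R"
    using finite_cochains[OF X q] finite_percolation_subcomplexes[OF X] by (simp_all add: F_def R_def)
  have potts: "potts_higgs \<beta>2 \<beta>1 q i X = normalized_pmf F w"
    unfolding potts_higgs_def F_def w_def higgs_weight_def ..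
  have perc: "coupled_percolation (1 - exp (- \<beta>2)) (1 - exp (- \<beta>1)) q i X = normalized_pmf R v"
    unfolding coupled_percolation_def R_def v_def b_def bernoulli_weight_def
    by (intro arg_cong2[where f = normalized_pmf] ext) (auto simp: mult_ac)
  have expand: "(\<Sum>f\<in>F. of_real (w f) * h f)
      = of_real C * (\<Sum>P\<in>R. of_real (b P) * (\<Sum>f\<in>rel_cocycles X q (fst P) (snd P) i. h f))"
    for h :: "('c oriented \<Rightarrow> int) \<Rightarrow> complex"
    unfolding F_def w_def C_def R_def b_def sum_higgs_weight[OF X q] by (simp add: case_prod_unfold)
  have v_eq: "v P = b P * real (card (rel_cocycles X q (fst P) (snd P) i))" if "P \<in> R" for P
    using that by (auto simp: R_def v_def card_rel_cohomology_percolation[OF _ percolation_subset q])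
  have numerator: "(\<Sum>f\<in>F. of_real (w f) * wilson X q i \<gamma> f)
      = of_real C * (\<Sum>P\<in>R. of_real (v P) * indicator ?V P)"
    unfolding expand
  proof (intro arg_cong[where f = "(*) _"] sum.cong refl)
    fix P assume P: "P \<in> R"
    then have "(\<Sum>f\<in>rel_cocycles X q (fst P) (snd P) i. wilson X q i \<gamma> f)
        = of_nat (card (rel_cocycles X q (fst P) (snd P) i)) * indicator ?V P"
      using sum_wilson_rel_cocycles[OF X q \<gamma>, of "fst P" "snd P"] by (auto simp: R_def)
    then show "of_real (b P) * (\<Sum>f\<in>rel_cocycles X q (fst P) (snd P) i. wilson X q i \<gamma> f)
        = of_real (v P) * indicator ?V P"
      using P by (simp add: v_eq)
  qed
  have "complex_of_real (sum w F) = of_real (C * sum v R)"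
    using expand[of "\<lambda>_. 1"] v_eq by simp
  then have denominator: "sum w F = C * sum v R"
    by (simp only: of_real_eq_iff)
  have C: "C > 0"
    by (simp add: C_def)
  have w: "w f > 0" for f
    by (simp add: w_def higgs_weight_def)
  have "(\<lambda>x. 0) \<in> F"
    using q by (simp add: F_def rel_cochains_def)
  then have sum_w: "sum w F > 0"
    using fin w by (intro sum_pos) auto
  then have sum_v: "sum v R > 0"
    using C by (simp add: denominator zero_less_mult_iff)
  have v: "v P \<ge> 0" for P
    using assms(3,4) by (auto simp: v_def b_def bernoulli_weight_def split: prod.split)
  have "measure_pmf.expectation (potts_higgs \<beta>2 \<beta>1 q i X) (wilson X q i \<gamma>)
      = (\<Sum>f\<in>F. of_real (w f) * wilson X q i \<gamma> f) / of_real (sum w F)"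
    using fin w sum_w unfolding potts
    by (subst expectation_normalized_pmf) (auto simp: scaleR_conv_of_real less_imp_le sum_divide_distrib)
  also have "\<dots> = of_real ((\<Sum>P\<in>R. v P * indicator ?V P) / sum v R)"
    unfolding numerator denominator using C by (simp add: of_real_indicator)
  also have "(\<Sum>P\<in>R. v P * indicator ?V P) / sum v R
      = measure_pmf.expectation (normalized_pmf R v) (indicator ?V)"
    unfolding expectation_normalized_pmf[OF fin(2) v sum_v]
    by (simp only: sum_divide_distrib real_scaleR_def times_divide_eq_left)
  also have "\<dots> = measure_pmf.prob (normalized_pmf R v) ?V"
    by simp
  finally show ?thesis
    unfolding perc .
qed

end
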